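(* Let $T$ be the binary rooted tree. Let $k\ge1$, $n\ge1$ be integers with $k+n\ge3$, and let $w=y_1\cdots y_k$ and $v=x_1\cdots x_n$ be words with letters in $\{0,1\}$ such that $y_k\ne x_n$. Let $\mathfrak K(w,v)=\langle b_1,\dots,b_k,a_1,\dots,a_n\rangle\subset\mathrm{Aut}(T)$, where $$b_1=\sigma,\qquad b_{j+1}=\begin{cases}(b_j,1)&y_j=0\\(1,b_j)&y_j=1\end{cases}\ (1\le j\le k-1),$$ $$a_1=\begin{cases}(b_k,a_n)&y_k=0,\ x_n=1\\(a_n,b_k)&y_k=1,\ x_n=0\end{cases},\qquad a_{i+1}=\begin{cases}(a_i,1)&x_i=0\\(1,a_i)&x_i=1\end{cases}\ (1\le i\le n-1).$$ Then $\mathfrak K(w,v)$ contains a non-Hausdorff element, and so the germinal groupoid associated to the action of $\mathfrak K(w,v)$ on $\partial T$ has non-Hausdorff topology.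
   Context: The binary rooted tree $T$ has as vertices the finite words over $\{0,1\}$ (root = empty word), each word $u$ joined by edges to $u0,u1$. $\partial T$ is the set of infinite words over $\{0,1\}$ with the product topology; $\mathrm{Aut}(T)$ acts on it by homeomorphisms. $\sigma\in\mathrm{Aut}(T)$ changes the first letter $z_1\mapsto z_1+1\bmod 2$ and fixes all other letters. For $g_0,g_1\in\mathrm{Aut}(T)$, $(g_0,g_1)$ denotes the automorphism $(g_0,g_1)(zu)=z\,g_z(u)$ for a letter $z$; $1$ is the identity. An element $g$ of a group $\Gamma$ acting on $\mathfrak X$ is non-Hausdorff at $y\in\mathfrak X$ if $g\cdot y=y$, $g$ is not the identity on any open neighborhood of $y$, and every neighborhood $W$ of $y$ contains a nonempty open set $O$ with $g|_O=\mathrm{id}$; $g$ is a non-Hausdorff element if it is non-Hausdorff at some $y$. Germinal groupoid of an action of a group $\Gamma$ on $\mathfrak X$: for $g\in\Gamma$, $y\in\mathfrak X$, the germ $[g]_y$ is the class of $g$ under $g_1\sim_y g_2$ iff $g_1\cdot y=g_2\cdot y$ and $g_1,g_2$ agree on an open neighborhood of $y$. The germinal groupoid is the set of all germs $[g]_y$ with the sheaf topology, with basis the sets $\{[g]_y\mid y\in U\}$, $g\in\Gamma$, $U\subset\mathfrak X$ open. *)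

theory Defs
  imports "HOL-Analysis.Analysis" "HOL-Algebra.Generated_Groups" "HOL-Library.Z2"
begin

section \<open>Germs of an action on a topological space\<close>

text \<open>
  A group \<open>G\<close> acts on the points of a topological space \<open>X\<close> through \<open>act\<close>.
\<close>

definition non_Hausdorff_at ::
    "('g \<Rightarrow> 'x \<Rightarrow> 'x) \<Rightarrow> 'x topology \<Rightarrow> 'g \<Rightarrow> 'x \<Rightarrow> bool" where
  "non_Hausdorff_at act X g y \<longleftrightarrow>
     y \<in> topspace X \<and>
     act g y = y \<and>
     \<not> (\<exists>U. openin X U \<and> y \<in> U \<and> (\<forall>z\<in>U. act g z = z)) \<and>
     (\<forall>W. openin X W \<and> y \<in> W \<longrightarrow>
        (\<exists>V. openin X V \<and> V \<noteq> {} \<and> V \<subseteq> W \<and> (\<forall>z\<in>V. act g z = z)))"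

definition non_Hausdorff_element ::
    "('g \<Rightarrow> 'x \<Rightarrow> 'x) \<Rightarrow> 'x topology \<Rightarrow> 'g \<Rightarrow> bool" where
  "non_Hausdorff_element act X g \<longleftrightarrow> (\<exists>y. non_Hausdorff_at act X g y)"

definition same_germ ::
    "('g \<Rightarrow> 'x \<Rightarrow> 'x) \<Rightarrow> 'x topology \<Rightarrow> 'x \<Rightarrow> 'g \<Rightarrow> 'g \<Rightarrow> bool" where
  "same_germ act X y g h \<longleftrightarrow>
     act g y = act h y \<and>
     (\<exists>U. openin X U \<and> y \<in> U \<and> (\<forall>z\<in>U. act g z = act h z))"

text \<open>
  The base point is kept as a component: a germ has a source, and classes taken at
  different points may coincide as subsets of \<open>G\<close>.
\<close>

definition germ ::
    "('g, 'm) monoid_scheme \<Rightarrow> ('g \<Rightarrow> 'x \<Rightarrow> 'x) \<Rightarrow> 'x topology \<Rightarrow> 'g \<Rightarrow> 'x \<Rightarrow> 'x \<times> 'g set"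
  where "germ G act X g y = (y, {h \<in> carrier G. same_germ act X y g h})"

definition germ_basis ::
    "('g, 'm) monoid_scheme \<Rightarrow> ('g \<Rightarrow> 'x \<Rightarrow> 'x) \<Rightarrow> 'x topology \<Rightarrow> ('x \<times> 'g set) set set"
  where "germ_basis G act X = {germ G act X g ` U | g U. g \<in> carrier G \<and> openin X U}"

text \<open>
  The topology with basis \<^const>\<open>germ_basis\<close>; that this family is indeed a basis is lemma
  \<open>germ_basis_Int\<close> below.
\<close>

definition germinal_groupoid ::
    "('g, 'm) monoid_scheme \<Rightarrow> ('g \<Rightarrow> 'x \<Rightarrow> 'x) \<Rightarrow> 'x topology \<Rightarrow> ('x \<times> 'g set) topology"
  where "germinal_groupoid G act X =
    topology (arbitrary union_of (\<lambda>B. B \<in> germ_basis G act X))"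

lemma same_germ_sym: "same_germ act X y g h \<Longrightarrow> same_germ act X y h g"
  unfolding same_germ_def by metis

lemma same_germ_trans:
  assumes "same_germ act X y g h" and "same_germ act X y h f"
  shows "same_germ act X y g f"
proof -
  obtain U where U: "openin X U" "y \<in> U" "\<forall>z\<in>U. act g z = act h z"
    using assms(1) by (auto simp: same_germ_def)
  obtain V where V: "openin X V" "y \<in> V" "\<forall>z\<in>V. act h z = act f z"
    using assms(2) by (auto simp: same_germ_def)
  have "openin X (U \<inter> V)" "y \<in> U \<inter> V" "\<forall>z\<in>U \<inter> V. act g z = act f z"
    using U V by auto
  then show ?thesis
    unfolding same_germ_def by metis
qed

lemma germ_eq_iff:
  assumes "h \<in> carrier G" and "y \<in> topspace X"
  shows "germ G act X g y = germ G act X h z \<longleftrightarrow> y = z \<and> same_germ act X y g h"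
proof
  assume eq: "germ G act X g y = germ G act X h z"
  have "same_germ act X y h h"
    unfolding same_germ_def using assms(2) openin_topspace by metis
  then show "y = z \<and> same_germ act X y g h"
    using eq assms(1) unfolding germ_def by auto
next
  assume "y = z \<and> same_germ act X y g h"
  then show "germ G act X g y = germ G act X h z"
    unfolding germ_def by (auto intro: same_germ_sym same_germ_trans)
qed

lemma germ_basis_Int:
  assumes "A \<in> germ_basis G act X" and "B \<in> germ_basis G act X"
  shows "A \<inter> B \<in> germ_basis G act X"
proof -
  obtain g U where A: "A = germ G act X g ` U" "g \<in> carrier G" "openin X U"
    using assms(1) by (auto simp: germ_basis_def)
  obtain h V where B: "B = germ G act X h ` V" "h \<in> carrier G" "openin X V"
    using assms(2) by (auto simp: germ_basis_def)
  define E where "E = \<Union> {W. openin X W \<and> (\<forall>z\<in>W. act g z = act h z)}"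
  have E: "openin X E"
    unfolding E_def by auto
  have inE: "z \<in> E \<longleftrightarrow> same_germ act X z g h" for z
    unfolding E_def same_germ_def by auto
  have top: "z \<in> topspace X" if "z \<in> U" for z
    using A(3) that openin_subset by auto
  have "A \<inter> B = germ G act X g ` (U \<inter> V \<inter> E)"
  proof (intro equalityI subsetI)
    fix c assume "c \<in> A \<inter> B"
    then obtain y z where "c = germ G act X g y" "y \<in> U" "c = germ G act X h z" "z \<in> V"
      unfolding A(1) B(1) by blast
    then show "c \<in> germ G act X g ` (U \<inter> V \<inter> E)"
      using germ_eq_iff[OF B(2) top] inE by fastforce
  next
    fix c assume "c \<in> germ G act X g ` (U \<inter> V \<inter> E)"
    then obtain y where y: "c = germ G act X g y" "y \<in> U" "y \<in> V" "y \<in> E" by auto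
    then have "c = germ G act X h y"
      using germ_eq_iff[OF B(2) top] inE by metis
    then show "c \<in> A \<inter> B" using y unfolding A(1) B(1) by blast
  qed
  moreover have "openin X (U \<inter> V \<inter> E)" using A B E by auto
  ultimately show ?thesis
    unfolding germ_basis_def using A(2) by blast
qed

lemma openin_germinal_groupoid_iff:
  "openin (germinal_groupoid G act X) S \<longleftrightarrow>
     (arbitrary union_of (\<lambda>B. B \<in> germ_basis G act X)) S"
  unfolding germinal_groupoid_def
  by (subst topology_inverse') (auto intro: istopology_base germ_basis_Int)

lemma topspace_germinal_groupoid:
  "topspace (germinal_groupoid G act X) =
     {germ G act X g y | g y. g \<in> carrier G \<and> y \<in> topspace X}"
proof (intro equalityI subsetI)
  fix c assume "c \<in> topspace (germinal_groupoid G act X)"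
  then obtain S where "openin (germinal_groupoid G act X) S" "c \<in> S"
    using openin_topspace by blast
  then obtain B where "B \<in> germ_basis G act X" "c \<in> B"
    unfolding openin_germinal_groupoid_iff arbitrary_union_of_alt by blast
  then obtain g U where "c \<in> germ G act X g ` U" "g \<in> carrier G" "openin X U"
    unfolding germ_basis_def by blast
  then show "c \<in> {germ G act X g y | g y. g \<in> carrier G \<and> y \<in> topspace X}"
    using openin_subset by blast
next
  fix c assume "c \<in> {germ G act X g y | g y. g \<in> carrier G \<and> y \<in> topspace X}"
  then obtain g y where c: "c = germ G act X g y" "g \<in> carrier G" "y \<in> topspace X" by blast
  then have "germ G act X g ` topspace X \<in> germ_basis G act X"
    unfolding germ_basis_def using openin_topspace by blast
  then have "openin (germinal_groupoid G act X) (germ G act X g ` topspace X)"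
    unfolding openin_germinal_groupoid_iff by (rule arbitrary_union_of_inc)
  then show "c \<in> topspace (germinal_groupoid G act X)"
    using c openin_subset by blast
qed

section \<open>The binary rooted tree\<close>

type_synonym word = "bit list"

definition tree_edge :: "word \<Rightarrow> word \<Rightarrow> bool" where
  "tree_edge u u' \<longleftrightarrow> (\<exists>z. u' = u @ [z] \<or> u = u' @ [z])"

definition tree_auts :: "(word \<Rightarrow> word) set" where
  "tree_auts = {g. bij g \<and> g [] = [] \<and> (\<forall>u u'. tree_edge (g u) (g u') \<longleftrightarrow> tree_edge u u')}"

definition AutT :: "(word \<Rightarrow> word) monoid" where
  "AutT = \<lparr>carrier = tree_auts, mult = (\<circ>), one = id\<rparr>"

lemma group_AutT: "group AutT"
proof (rule groupI)
  fix g assume "g \<in> carrier AutT"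
  then have g: "bij g" "g [] = []" "\<And>u u'. tree_edge (g u) (g u') \<longleftrightarrow> tree_edge u u'"
    by (auto simp: AutT_def tree_auts_def)
  have "tree_edge (inv_into UNIV g u) (inv_into UNIV g u') \<longleftrightarrow> tree_edge u u'" for u u'
    using g(3)[of "inv_into UNIV g u" "inv_into UNIV g u'"] g(1) by (simp add: bij_is_surj surj_f_inv_f)
  moreover have "inv_into UNIV g [] = []"
    using g(1,2) by (metis bij_inv_eq_iff)
  moreover have "inv_into UNIV g \<circ> g = id"
    using g(1) by (simp add: bij_is_inj)
  ultimately show "\<exists>h\<in>carrier AutT. h \<otimes>\<^bsub>AutT\<^esub> g = \<one>\<^bsub>AutT\<^esub>"
    using g(1) by (intro bexI[of _ "inv_into UNIV g"]) (auto simp: AutT_def tree_auts_def bij_imp_bij_inv)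
qed (auto simp: AutT_def tree_auts_def bij_comp)

text \<open>An automorphism acts on an infinite word through its finite prefixes.\<close>

definition boundary_act :: "(word \<Rightarrow> word) \<Rightarrow> (nat \<Rightarrow> bit) \<Rightarrow> (nat \<Rightarrow> bit)" where
  "boundary_act g \<xi> = (\<lambda>i. g (map \<xi> [0..<Suc i]) ! i)"

definition boundary :: "(nat \<Rightarrow> bit) topology" where
  "boundary = product_topology (\<lambda>_. discrete_topology UNIV) UNIV"

lemma topspace_boundary: "topspace boundary = UNIV"
  by (simp add: boundary_def)

lemma tree_aut_snoc:
  assumes g: "g \<in> tree_auts"
  shows "\<exists>z'. g (u @ [z]) = g u @ [z']"
proof (induction u arbitrary: z rule: rev_induct)
  case Nil
  have "tree_edge [] [z]"
    by (simp add: tree_edge_def)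
  moreover have nil: "g [] = []"
    using g by (simp add: tree_auts_def)
  ultimately have "tree_edge [] (g [z])"
    using g unfolding tree_auts_def by (metis (mono_tags, lifting) mem_Collect_eq)
  then show ?case
    using nil by (auto simp: tree_edge_def)
next
  case (snoc t u)
  obtain t' where t': "g (u @ [t]) = g u @ [t']"
    using snoc by blast
  have "tree_edge (g (u @ [t])) (g ((u @ [t]) @ [z]))"
    using g by (auto simp: tree_auts_def tree_edge_def simp del: append_assoc)
  moreover have "g (u @ [t]) \<noteq> g ((u @ [t]) @ [z]) @ [z']" for z'
  proof
    assume "g (u @ [t]) = g ((u @ [t]) @ [z]) @ [z']"
    then have "g u = g ((u @ [t]) @ [z])"
      using t' by simp
    moreover have "inj g"
      using g by (auto simp: tree_auts_def bij_is_inj)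
    ultimately have "u = (u @ [t]) @ [z]"
      by (rule injD[rotated])
    then show False by simp
  qed
  ultimately show ?case
    unfolding tree_edge_def by blast
qed

lemma tree_aut_length: "g \<in> tree_auts \<Longrightarrow> length (g u) = length u"
proof (induction u rule: rev_induct)
  case Nil
  then show ?case by (simp add: tree_auts_def)
next
  case (snoc z u)
  then show ?case using tree_aut_snoc[of g u z] by auto
qed

lemma prefix_boundary_act:
  assumes g: "g \<in> tree_auts"
  shows "map (boundary_act g \<xi>) [0..<m] = g (map \<xi> [0..<m])"
proof (induction m)
  case 0
  then show ?case using g by (simp add: tree_auts_def)
next
  case (Suc m)
  obtain z where z: "g (map \<xi> [0..<m] @ [\<xi> m]) = g (map \<xi> [0..<m]) @ [z]"
    using tree_aut_snoc[OF g] by blast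
  have "boundary_act g \<xi> m = z"
    using z by (simp add: boundary_act_def nth_append tree_aut_length[OF g])
  then show ?case using Suc z by simp
qed

lemma boundary_act_id: "boundary_act id = id"
  by (auto simp: boundary_act_def fun_eq_iff nth_append)

lemma boundary_act_comp:
  assumes "h \<in> tree_auts"
  shows "boundary_act (g \<circ> h) = boundary_act g \<circ> boundary_act h"
  by (simp add: fun_eq_iff boundary_act_def[of g] boundary_act_def[of "g \<circ> h"]
      prefix_boundary_act[OF assms] del: upt_Suc)

section \<open>The kneading automorphisms\<close>

fun switch :: "word \<Rightarrow> word" where
  "switch [] = []"
| "switch (z # u) = (z + 1) # u"

text \<open>The automorphism \<open>(g0, g1)\<close>, with sections \<open>g0\<close> and \<open>g1\<close>.\<close>

fun wreath :: "(word \<Rightarrow> word) \<Rightarrow> (word \<Rightarrow> word) \<Rightarrow> word \<Rightarrow> word" where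
  "wreath g0 g1 [] = []"
| "wreath g0 g1 (z # u) = z # (if z = 0 then g0 u else g1 u)"

text \<open>
  The letters of the words \<open>w = y 1 \<dots> y k\<close> and \<open>v = x 1 \<dots> x n\<close>, and the generators, are
  indexed from 1; values at other indices play no role. The equations for the \<open>a i\<close> are
  cyclic; lemmas \<open>ex_kneading_generators\<close> and \<open>kneading_generators_unique\<close> below show that
  they have exactly one solution.
\<close>

definition kneading_generators ::
    "nat \<Rightarrow> nat \<Rightarrow> (nat \<Rightarrow> bit) \<Rightarrow> (nat \<Rightarrow> bit) \<Rightarrow>
     (nat \<Rightarrow> word \<Rightarrow> word) \<Rightarrow> (nat \<Rightarrow> word \<Rightarrow> word) \<Rightarrow> bool" where
  "kneading_generators k n y x b a \<longleftrightarrow>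
     (\<forall>j. 1 \<le> j \<and> j \<le> k \<longrightarrow> b j \<in> carrier AutT) \<and>
     (\<forall>i. 1 \<le> i \<and> i \<le> n \<longrightarrow> a i \<in> carrier AutT) \<and>
     b 1 = switch \<and>
     (\<forall>j. 1 \<le> j \<and> j < k \<longrightarrow>
        b (j + 1) = (if y j = 0 then wreath (b j) id else wreath id (b j))) \<and>
     (y k = 0 \<and> x n = 1 \<longrightarrow> a 1 = wreath (b k) (a n)) \<and>
     (y k = 1 \<and> x n = 0 \<longrightarrow> a 1 = wreath (a n) (b k)) \<and>
     (\<forall>i. 1 \<le> i \<and> i < n \<longrightarrow>
        a (i + 1) = (if x i = 0 then wreath (a i) id else wreath id (a i)))"

definition kneading_group ::
    "nat \<Rightarrow> nat \<Rightarrow> (nat \<Rightarrow> word \<Rightarrow> word) \<Rightarrow> (nat \<Rightarrow> word \<Rightarrow> word) \<Rightarrow> (word \<Rightarrow> word) monoid" where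
  "kneading_group k n b a = subgroup_generated AutT (b ` {1..k} \<union> a ` {1..n})"

lemma tree_edge_Nil: "tree_edge [] u \<longleftrightarrow> length u = 1" "tree_edge u [] \<longleftrightarrow> length u = 1"
  by (auto simp: tree_edge_def length_Suc_conv)

lemma tree_edge_Cons: "tree_edge (z # u) (z' # u') \<longleftrightarrow>
    (z = z' \<and> tree_edge u u')"
  by (auto simp: tree_edge_def)

lemma involution_tree_aut:
  assumes inv: "\<And>u. g (g u) = u" and Nil: "g [] = []"
    and edge: "\<And>u u'. tree_edge u u' \<Longrightarrow> tree_edge (g u) (g u')"
  shows "g \<in> tree_auts"
proof -
  have "bij g"
    by (rule o_bij[of g]) (auto simp: inv fun_eq_iff)
  moreover have "tree_edge u u'" if "tree_edge (g u) (g u')" for u u'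
    using edge[OF that] inv by simp
  ultimately show ?thesis
    using Nil edge unfolding tree_auts_def by blast
qed

text \<open>The solution of the equations, by recursion on the argument word.\<close>

fun b_sol :: "(nat \<Rightarrow> bit) \<Rightarrow> nat \<Rightarrow> word \<Rightarrow> word" where
  "b_sol y j [] = []"
| "b_sol y j (z # u) =
     (if j \<le> 1 then (z + 1) # u
      else if z = y (j - 1) then z # b_sol y (j - 1) u
      else z # u)"

fun a_sol :: "nat \<Rightarrow> nat \<Rightarrow> (nat \<Rightarrow> bit) \<Rightarrow> (nat \<Rightarrow> bit) \<Rightarrow> nat \<Rightarrow> word \<Rightarrow> word" where
  "a_sol k n y x i [] = []"
| "a_sol k n y x i (z # u) =
     (if i \<le> 1 then z # (if z = y k then b_sol y k u else a_sol k n y x n u)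
      else if z = x (i - 1) then z # a_sol k n y x (i - 1) u
      else z # u)"

lemma length_b_sol: "length (b_sol y j u) = length u"
  by (induction y j u rule: b_sol.induct) auto

lemma length_a_sol: "length (a_sol k n y x i u) = length u"
  by (induction k n y x i u rule: a_sol.induct) (auto simp: length_b_sol)

lemma b_sol_in_tree_auts: "b_sol y j \<in> tree_auts"
proof (rule involution_tree_aut)
  show "b_sol y j (b_sol y j u) = u" for u
    by (induction y j u rule: b_sol.induct) (auto simp: add.assoc)
  show "tree_edge (b_sol y j u) (b_sol y j u')" if "tree_edge u u'" for u u'
    using that
  proof (induction u arbitrary: u' j)
    case Nil
    then show ?case by (simp add: tree_edge_Nil length_b_sol)
  next
    case (Cons z u)
    then show ?case
      by (cases u') (auto simp: tree_edge_Nil tree_edge_Cons length_b_sol)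
  qed
qed simp

lemma a_sol_in_tree_auts: "a_sol k n y x i \<in> tree_auts"
proof (rule involution_tree_aut)
  have b: "b_sol y j (b_sol y j u) = u" for j u
    by (induction y j u rule: b_sol.induct) (auto simp: add.assoc)
  show "a_sol k n y x i (a_sol k n y x i u) = u" for u
    by (induction u arbitrary: i) (auto simp: b)
  have be: "tree_edge (b_sol y j u) (b_sol y j u')" if "tree_edge u u'" for j u u'
    using b_sol_in_tree_auts[of y j] that by (simp add: tree_auts_def)
  show "tree_edge (a_sol k n y x i u) (a_sol k n y x i u')" if "tree_edge u u'" for u u'
    using that
  proof (induction u arbitrary: u' i)
    case Nil
    then show ?case by (simp add: tree_edge_Nil length_a_sol)
  next
    case (Cons z u)
    then show ?case
      by (cases u') (auto simp: tree_edge_Nil tree_edge_Cons length_a_sol length_b_sol be)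
  qed
qed simp

lemma wreath_eqI:
  "f [] = [] \<Longrightarrow> (\<And>u. f (0 # u) = 0 # g0 u) \<Longrightarrow> (\<And>u. f (1 # u) = 1 # g1 u) \<Longrightarrow> f = wreath g0 g1"
proof
  fix u assume "f [] = []" "\<And>u. f (0 # u) = 0 # g0 u" "\<And>u. f (1 # u) = 1 # g1 u"
  then show "f u = wreath g0 g1 u"
    by (cases "(g0, g1, u)" rule: wreath.cases) (auto split: if_splits)
qed

lemma ex_kneading_generators: "\<exists>b a. kneading_generators k n y x b a"
proof (intro exI)
  have "b_sol y 1 = switch"
  proof
    show "b_sol y 1 u = switch u" for u by (cases u) auto
  qed
  moreover have "b_sol y (j + 1) =
      (if y j = 0 then wreath (b_sol y j) id else wreath id (b_sol y j))" if "1 \<le> j" for j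
    using that by (auto intro!: wreath_eqI)
  moreover have "a_sol k n y x (i + 1) =
      (if x i = 0 then wreath (a_sol k n y x i) id else wreath id (a_sol k n y x i))" if "1 \<le> i" for i
    using that by (auto intro!: wreath_eqI)
  moreover have "a_sol k n y x 1 = wreath (b_sol y k) (a_sol k n y x n)" if "y k = 0"
    using that by (auto intro!: wreath_eqI)
  moreover have "a_sol k n y x 1 = wreath (a_sol k n y x n) (b_sol y k)" if "y k = 1"
    using that by (auto intro!: wreath_eqI)
  ultimately show "kneading_generators k n y x (b_sol y) (a_sol k n y x)"
    unfolding kneading_generators_def
    by (simp add: AutT_def b_sol_in_tree_auts a_sol_in_tree_auts)
qed

lemma kneading_generators_unique:
  assumes "kneading_generators k n y x b a" and "kneading_generators k n y x b' a'"
    and "y k \<noteq> x n" and "1 \<le> k"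
  shows "1 \<le> j \<Longrightarrow> j \<le> k \<Longrightarrow> b j = b' j"
    and "1 \<le> i \<Longrightarrow> i \<le> n \<Longrightarrow> a i = a' i"
proof -
  have b: "b j = b' j" if "1 \<le> j" "j \<le> k" for j
    using that
  proof (induction j rule: dec_induct)
    case base
    then show ?case using assms(1,2) by (simp add: kneading_generators_def)
  next
    case (step j)
    then have "b (j + 1) = b' (j + 1)"
      using assms(1,2) by (simp add: kneading_generators_def)
    then show ?case by simp
  qed
  then show "1 \<le> j \<Longrightarrow> j \<le> k \<Longrightarrow> b j = b' j" .
  have bk: "b k = b' k" using b assms(4) by blast
  have "a i u = a' i u" if "1 \<le> i" "i \<le> n" for i u
    using that
  proof (induction u arbitrary: i)
    case Nil
    then show ?case
      using assms(1,2) by (simp add: kneading_generators_def AutT_def tree_auts_def)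
  next
    case (Cons z u)
    have yx: "y k = 0 \<and> x n = 1 \<or> y k = 1 \<and> x n = 0"
      using assms(3) by (cases "y k"; cases "x n") auto
    show ?case
    proof (cases "i = 1")
      case True
      have "a n u = a' n u" using Cons by auto
      moreover have "y k = 0 \<Longrightarrow> a 1 = wreath (b k) (a n)" "y k = 0 \<Longrightarrow> a' 1 = wreath (b' k) (a' n)"
        "y k = 1 \<Longrightarrow> a 1 = wreath (a n) (b k)" "y k = 1 \<Longrightarrow> a' 1 = wreath (a' n) (b' k)"
        using assms(1,2) yx by (auto simp: kneading_generators_def)
      ultimately show ?thesis
        unfolding True using yx bk by auto
    next
      case False
      then obtain m where m: "i = m + 1" "1 \<le> m" "m < n"
        using Cons.prems by (metis Suc_eq_plus1 Suc_le_D le_neq_implies_less less_Suc_eq_le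
            Suc_le_eq One_nat_def)
      have "a m u = a' m u" using Cons m by auto
      moreover have "a i = (if x m = 0 then wreath (a m) id else wreath id (a m))"
        "a' i = (if x m = 0 then wreath (a' m) id else wreath id (a' m))"
        using assms(1,2) m by (auto simp: kneading_generators_def)
      ultimately show ?thesis by auto
    qed
  qed
  then show "1 \<le> i \<Longrightarrow> i \<le> n \<Longrightarrow> a i = a' i" by blast
qed

end

theory Submission
  imports Defs
begin

text \<open>
  The generator \<open>a 1\<close> is itself non-Hausdorff. Following the letters \<open>x n, \<dots>, x 1\<close> through the
  recursion, \<open>a 1\<close> fixes the word \<open>P = x n \<dots> x 1\<close> and acts below its nonempty prefixes as \<open>a n, \<dots>, a 1\<close>
  in turn, so that its section at \<open>P\<close> is \<open>a 1\<close> again. Hence \<open>a 1\<close> fixes the periodic point \<open>P P P \<dots>\<close>, and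
  its behaviour near that point is repeated at every scale: if \<open>a 1\<close> moves some word and has the
  identity as its section at some other word, then both happen arbitrarily close to the periodic
  point (lemma \<open>non_Hausdorff_at_periodic_point\<close>).

  The section of \<open>a 1\<close> at \<open>y k\<close> is \<open>b k\<close>, which has the nontrivial section \<open>\<sigma>\<close> at
  \<open>y (k - 1) \<dots> y 1\<close>. The identity is a section of \<open>b k\<close> when \<open>k \<ge> 2\<close>, and of \<open>a n\<close> when \<open>n \<ge> 2\<close>;
  one of the two holds because \<open>k + n \<ge> 3\<close>.

  For the groupoid, a non-Hausdorff element and the identity have different germs at the
  singular point, but any neighborhoods of these germs share the common germs over a nonempty open
  set on which the element is trivial (lemma \<open>non_Hausdorff_groupoid\<close>).
\<close>

section \<open>Non-Hausdorff elements and the germinal groupoid\<close>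

lemma germs_in_open_near:
  assumes S: "openin (germinal_groupoid G act X) S" "germ G act X g y \<in> S"
    and y: "y \<in> topspace X"
  obtains W where "openin X W" "y \<in> W" "\<And>z. z \<in> W \<Longrightarrow> germ G act X g z \<in> S"
proof -
  obtain B where "B \<in> germ_basis G act X" "germ G act X g y \<in> B" "B \<subseteq> S"
    using S unfolding openin_germinal_groupoid_iff arbitrary_union_of_alt by blast
  then obtain h U where h: "h \<in> carrier G" "openin X U"
      "germ G act X g y \<in> germ G act X h ` U" "germ G act X h ` U \<subseteq> S"
    unfolding germ_basis_def by blast
  then have "y \<in> U" "same_germ act X y g h"
    using germ_eq_iff[OF h(1) y] by auto
  then obtain U' where U': "openin X U'" "y \<in> U'" "\<forall>z\<in>U'. act g z = act h z"
    unfolding same_germ_def by blast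
  show thesis
  proof
    show "openin X (U \<inter> U')" "y \<in> U \<inter> U'"
      using h(2) U' \<open>y \<in> U\<close> by auto
    fix z assume z: "z \<in> U \<inter> U'"
    then have "same_germ act X z g h"
      unfolding same_germ_def using U' by blast
    moreover have "z \<in> topspace X"
      using z openin_subset[OF h(2)] by blast
    ultimately have "germ G act X g z = germ G act X h z"
      using germ_eq_iff[OF h(1)] by metis
    then show "germ G act X g z \<in> S"
      using z h(4) by auto
  qed
qed

lemma non_Hausdorff_groupoid:
  assumes g: "g \<in> carrier G" "non_Hausdorff_at act X g y"
    and e: "e \<in> carrier G" "\<And>z. act e z = z"
  shows "\<not> Hausdorff_space (germinal_groupoid G act X)"
proof
  let ?X = "germinal_groupoid G act X"
  assume haus: "Hausdorff_space ?X"
  have y: "y \<in> topspace X" and nontriv: "\<not> (\<exists>U. openin X U \<and> y \<in> U \<and> (\<forall>z\<in>U. act g z = z))"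
    and triv: "\<And>W. openin X W \<Longrightarrow> y \<in> W \<Longrightarrow>
        \<exists>V. openin X V \<and> V \<noteq> {} \<and> V \<subseteq> W \<and> (\<forall>z\<in>V. act g z = z)"
    using g(2) unfolding non_Hausdorff_at_def by simp_all
  have "germ G act X g y \<noteq> germ G act X e y"
    using nontriv by (simp add: germ_eq_iff[OF e(1) y] same_germ_def e(2))
  moreover have "germ G act X g y \<in> topspace ?X" "germ G act X e y \<in> topspace ?X"
    using g(1) e(1) y unfolding topspace_germinal_groupoid by blast+
  ultimately obtain S T where ST: "openin ?X S" "openin ?X T"
      "germ G act X g y \<in> S" "germ G act X e y \<in> T" "disjnt S T"
    using haus unfolding Hausdorff_space_def by metis
  obtain W1 where W1: "openin X W1" "y \<in> W1" "\<And>z. z \<in> W1 \<Longrightarrow> germ G act X g z \<in> S"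
    using germs_in_open_near[OF ST(1,3) y] by blast
  obtain W2 where W2: "openin X W2" "y \<in> W2" "\<And>z. z \<in> W2 \<Longrightarrow> germ G act X e z \<in> T"
    using germs_in_open_near[OF ST(2,4) y] by blast
  obtain V where V: "openin X V" "V \<noteq> {}" "V \<subseteq> W1 \<inter> W2" "\<forall>z\<in>V. act g z = z"
    using triv[of "W1 \<inter> W2"] W1 W2 by auto
  obtain z where z: "z \<in> V"
    using V(2) by blast
  have "z \<in> topspace X"
    using z V(1) openin_subset by blast
  moreover have "same_germ act X z g e"
    unfolding same_germ_def e(2) using V(1,4) z by blast
  ultimately have "germ G act X g z = germ G act X e z"
    using germ_eq_iff[OF e(1)] by metis
  moreover have "germ G act X g z \<in> S" "germ G act X e z \<in> T"
    using W1(3) W2(3) V(3) z by auto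
  ultimately show False
    using ST(5) unfolding disjnt_iff by metis
qed

section \<open>Cylinder sets\<close>

text \<open>The set of infinite words with prefix \<open>u\<close>.\<close>

definition cylinder :: "word \<Rightarrow> (nat \<Rightarrow> bit) set" where
  "cylinder u = {\<xi>. map \<xi> [0..<length u] = u}"

lemma cylinder_nonempty: "cylinder u \<noteq> {}"
proof -
  have "map ((!) u) [0..<length u] = u"
    by (rule map_nth)
  then show ?thesis
    unfolding cylinder_def by blast
qed

lemma cylinder_iff_nth: "\<xi> \<in> cylinder u \<longleftrightarrow> (\<forall>i<length u. \<xi> i = u ! i)"
proof
  assume "\<xi> \<in> cylinder u"
  then have "map \<xi> [0..<length u] = u"
    by (simp add: cylinder_def)
  then show "\<forall>i<length u. \<xi> i = u ! i"
    by (metis add_0 diff_zero nth_map_upt)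
next
  assume "\<forall>i<length u. \<xi> i = u ! i"
  then have "map \<xi> [0..<length u] = u"
    by (intro nth_equalityI) simp_all
  then show "\<xi> \<in> cylinder u"
    by (simp add: cylinder_def)
qed

lemma cylinder_append_subset: "cylinder (u @ v) \<subseteq> cylinder u"
proof
  fix \<xi> assume "\<xi> \<in> cylinder (u @ v)"
  then have "\<xi> i = u ! i" if "i < length u" for i
    using that unfolding cylinder_iff_nth by (metis length_append nth_append trans_less_add1)
  then show "\<xi> \<in> cylinder u"
    unfolding cylinder_iff_nth by blast
qed

lemma openin_cylinder: "openin boundary (cylinder u)"
proof -
  define S where "S i = (if i < length u then {u ! i} else UNIV)" for i
  have "\<xi> \<in> cylinder u \<longleftrightarrow> (\<forall>i. \<xi> i \<in> S i)" for \<xi>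
    unfolding cylinder_iff_nth S_def by (metis UNIV_I singleton_iff)
  then have "cylinder u = PiE UNIV S"
    unfolding set_eq_iff PiE_UNIV_domain Pi_iff by blast
  moreover have "{i. S i \<noteq> topspace (discrete_topology UNIV)} \<subseteq> {..<length u}"
    unfolding S_def by fastforce
  then have "finite {i. S i \<noteq> topspace (discrete_topology UNIV)}"
    using finite_subset finite_lessThan by blast
  ultimately show ?thesis
    unfolding boundary_def by (simp only: product_topology_basis openin_discrete_topology subset_UNIV)
qed

lemma open_contains_cylinder:
  assumes "openin boundary W" and "\<xi> \<in> W"
  obtains m where "\<And>l. m \<le> l \<Longrightarrow> cylinder (map \<xi> [0..<l]) \<subseteq> W"
proof -
  obtain U where U: "finite {i. U i \<noteq> (UNIV :: bit set)}" "\<xi> \<in> PiE UNIV U" "PiE UNIV U \<subseteq> W"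
    using assms unfolding boundary_def openin_product_topology_alt by fastforce
  obtain m where m: "\<forall>i\<in>{i. U i \<noteq> UNIV}. i < m"
    using U(1) unfolding finite_nat_set_iff_bounded by blast
  show thesis
  proof
    fix l assume l: "m \<le> l"
    have "\<eta> i \<in> U i" if "\<eta> \<in> cylinder (map \<xi> [0..<l])" for \<eta> i
    proof (cases "i < l")
      case True
      then have "\<eta> i = \<xi> i"
        using that by (simp add: cylinder_iff_nth)
      then show ?thesis
        using U(2) unfolding PiE_UNIV_domain Pi_iff by simp
    next
      case False
      then have "U i = UNIV" using m l by auto
      then show ?thesis by simp
    qed
    then show "cylinder (map \<xi> [0..<l]) \<subseteq> W"
      using U(3) unfolding PiE_UNIV_domain Pi_iff by blast
  qed
qed

section \<open>Sections at fixed words\<close>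

text \<open>
  The map \<open>f\<close> preserves the subtree below the word \<open>u\<close> and acts there as \<open>h\<close>. Only sections
  at words fixed by \<open>f\<close> are needed.
\<close>

definition has_section :: "(word \<Rightarrow> word) \<Rightarrow> word \<Rightarrow> (word \<Rightarrow> word) \<Rightarrow> bool" where
  "has_section f u h \<longleftrightarrow> (\<forall>s. f (u @ s) = u @ h s)"

lemma has_section_Nil: "has_section f [] f"
  by (simp add: has_section_def)

lemma has_section_append:
  "has_section f u g \<Longrightarrow> has_section g v h \<Longrightarrow> has_section f (u @ v) h"
  by (simp add: has_section_def)

lemma has_section_wreath:
  "has_section (wreath g0 g1) [0] g0" "has_section (wreath g0 g1) [1] g1"
  by (simp_all add: has_section_def)

lemma has_section_power:
  assumes "has_section f P f"
  shows "has_section f (concat (replicate m P)) f"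
  by (induction m) (auto intro: has_section_Nil has_section_append assms)

lemma boundary_act_fixes_cylinder:
  assumes f: "f \<in> tree_auts" and sec: "has_section f u id" and \<xi>: "\<xi> \<in> cylinder u"
  shows "boundary_act f \<xi> = \<xi>"
proof
  fix i
  define m where "m = max (Suc i) (length u)"
  obtain d where d: "m = length u + d"
    unfolding m_def by (metis le_add_diff_inverse max.cobounded2)
  have "[0..<m] = [0..<length u] @ [length u..<m]"
    unfolding d using upt_add_eq_append[of 0 "length u" d] by simp
  then have "map \<xi> [0..<m] = u @ map \<xi> [length u..<m]"
    using \<xi> by (simp add: cylinder_def)
  then have "f (map \<xi> [0..<m]) = map \<xi> [0..<m]"
    using sec by (simp add: has_section_def)
  then have "map (boundary_act f \<xi>) [0..<m] ! i = map \<xi> [0..<m] ! i"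
    by (simp only: prefix_boundary_act[OF f])
  moreover have "i < m"
    by (simp add: m_def)
  ultimately show "boundary_act f \<xi> i = \<xi> i"
    by simp
qed

text \<open>The infinite word \<open>P P P \<dots>\<close>.\<close>

definition periodic_point :: "word \<Rightarrow> nat \<Rightarrow> bit" where
  "periodic_point P i = P ! (i mod length P)"

lemma prefix_periodic_point:
  "map (periodic_point P) [0..<m * length P] = concat (replicate m P)"
proof (induction m)
  case (Suc m)
  have "map (periodic_point P) [m * length P..<m * length P + length P] = P"
    by (rule nth_equalityI) (auto simp: periodic_point_def)
  moreover have "[0..<Suc m * length P] =
      [0..<m * length P] @ [m * length P..<m * length P + length P]"
    using upt_add_eq_append[of 0 "m * length P" "length P"] by (simp add: add.commute)
  moreover have "concat (replicate m P) @ P = P @ concat (replicate m P)"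
    by (induction m) auto
  ultimately show ?case
    using Suc by simp
qed simp

text \<open>
  An automorphism that reproduces itself below \<open>P\<close> sees all of its behaviour repeated in every
  neighborhood of \<open>P P P \<dots>\<close>, both a word \<open>q\<close> that it moves and a subtree that it fixes.
\<close>

lemma non_Hausdorff_at_periodic_point:
  assumes f: "f \<in> tree_auts" and P: "P \<noteq> []" "has_section f P f"
    and q: "f q \<noteq> q" and r: "has_section f r id"
  shows "non_Hausdorff_at boundary_act boundary f (periodic_point P)"
proof -
  let ?p = "periodic_point P"
  let ?c = "\<lambda>m. concat (replicate m P)"
  have sec: "f (?c m @ s) = ?c m @ f s" for m s
    using has_section_power[OF P(2)] by (simp add: has_section_def)
  have near: "\<exists>m. cylinder (?c m) \<subseteq> W" if W: "openin boundary W" "?p \<in> W" for W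
  proof -
    obtain m where m: "\<And>l. m \<le> l \<Longrightarrow> cylinder (map ?p [0..<l]) \<subseteq> W"
      using open_contains_cylinder[OF W] by blast
    have "m \<le> m * length P"
      using P(1) by (cases P) auto
    then show ?thesis
      using m[of "m * length P"] unfolding prefix_periodic_point by blast
  qed
  have "boundary_act f ?p = ?p"
  proof
    fix i
    have "f (?c (Suc i)) = ?c (Suc i)"
      using sec[of "Suc i" "[]"] f by (simp add: tree_auts_def)
    then have "map (boundary_act f ?p) [0..<Suc i * length P] ! i = map ?p [0..<Suc i * length P] ! i"
      by (simp only: prefix_boundary_act[OF f] prefix_periodic_point)
    moreover have "i < Suc i * length P"
      using P(1) by (cases P) auto
    ultimately show "boundary_act f ?p i = ?p i"
      by simp
  qed
  moreover have "\<exists>z\<in>W. boundary_act f z \<noteq> z" if W: "openin boundary W" "?p \<in> W" for W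
  proof -
    obtain m where m: "cylinder (?c m) \<subseteq> W"
      using near[OF W] by blast
    obtain z where z: "z \<in> cylinder (?c m @ q)"
      using cylinder_nonempty by blast
    define l where "l = length (?c m @ q)"
    have zl: "map z [0..<l] = ?c m @ q"
      using z unfolding cylinder_def l_def by blast
    have "map (boundary_act f z) [0..<l] \<noteq> map z [0..<l]"
      unfolding prefix_boundary_act[OF f] zl sec using q by simp
    then have "boundary_act f z \<noteq> z"
      by metis
    moreover have "z \<in> W"
      using z m cylinder_append_subset by blast
    ultimately show ?thesis by blast
  qed
  moreover have "\<exists>V. openin boundary V \<and> V \<noteq> {} \<and> V \<subseteq> W \<and> (\<forall>z\<in>V. boundary_act f z = z)"
    if W: "openin boundary W" "?p \<in> W" for W
  proof -
    obtain m where m: "cylinder (?c m) \<subseteq> W"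
      using near[OF W] by blast
    have "has_section f (?c m @ r) id"
      using has_section_append[OF has_section_power[OF P(2)] r] .
    then have "\<forall>z\<in>cylinder (?c m @ r). boundary_act f z = z"
      using boundary_act_fixes_cylinder[OF f] by blast
    moreover have "cylinder (?c m @ r) \<subseteq> W"
      using m cylinder_append_subset by blast
    ultimately show ?thesis
      using openin_cylinder cylinder_nonempty by (intro exI[of _ "cylinder (?c m @ r)"]) simp
  qed
  ultimately show ?thesis
    unfolding non_Hausdorff_at_def topspace_boundary by (metis UNIV_I)
qed

section \<open>Sections of the kneading automorphisms\<close>

lemma kneading_sections_step:
  assumes "kneading_generators k n y x b a"
  shows "1 \<le> j \<Longrightarrow> j < k \<Longrightarrow> has_section (b (Suc j)) [y j] (b j)"
    and "1 \<le> j \<Longrightarrow> j < k \<Longrightarrow> has_section (b (Suc j)) [y j + 1] id"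
    and "1 \<le> i \<Longrightarrow> i < n \<Longrightarrow> has_section (a (Suc i)) [x i] (a i)"
    and "1 \<le> i \<Longrightarrow> i < n \<Longrightarrow> has_section (a (Suc i)) [x i + 1] id"
  using assms
  by (cases "y j"; cases "x i"; simp add: kneading_generators_def has_section_wreath)+

lemma kneading_sections_first:
  assumes "kneading_generators k n y x b a" and "y k \<noteq> x n"
  shows "has_section (a 1) [y k] (b k)" and "has_section (a 1) [x n] (a n)"
  using assms
  by (cases "y k"; cases "x n"; simp add: kneading_generators_def has_section_wreath)+

lemma kneading_b_has_section_switch:
  assumes "kneading_generators k n y x b a" and "1 \<le> j" and "j \<le> k"
  shows "\<exists>u. has_section (b j) u switch"
  using assms(2,3)
proof (induction j rule: dec_induct)
  case base
  have "b 1 = switch"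
    using assms(1) by (simp add: kneading_generators_def)
  then show ?case
    using has_section_Nil by metis
next
  case (step j)
  then obtain u where u: "has_section (b j) u switch"
    by auto
  have "has_section (b (Suc j)) [y j] (b j)"
    using kneading_sections_step(1)[OF assms(1)] step.hyps step.prems by simp
  then show ?case
    using has_section_append u by blast
qed

lemma kneading_a_has_section_first:
  assumes "kneading_generators k n y x b a" and "1 \<le> i" and "i \<le> n"
  shows "\<exists>u. has_section (a i) u (a 1)"
  using assms(2,3)
proof (induction i rule: dec_induct)
  case base
  then show ?case
    using has_section_Nil by metis
next
  case (step i)
  then obtain u where u: "has_section (a i) u (a 1)"
    by auto
  have "has_section (a (Suc i)) [x i] (a i)"
    using kneading_sections_step(3)[OF assms(1)] step.hyps step.prems by simp
  then show ?case
    using has_section_append u by blast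
qed

lemma kneading_first_non_Hausdorff:
  assumes kn: "k \<ge> 1" "n \<ge> 1" "k + n \<ge> 3" and yx: "y k \<noteq> x n"
    and gen: "kneading_generators k n y x b a"
  shows "non_Hausdorff_element boundary_act boundary (a 1)"
proof -
  note first = kneading_sections_first[OF gen yx]
  have aut: "a 1 \<in> tree_auts"
    using gen kn(2) by (simp add: kneading_generators_def AutT_def)
  obtain u where "has_section (a n) u (a 1)"
    using kneading_a_has_section_first[OF gen kn(2)] by auto
  then have P: "has_section (a 1) ([x n] @ u) (a 1)"
    using has_section_append[OF first(2)] by blast
  obtain t where "has_section (b k) t switch"
    using kneading_b_has_section_switch[OF gen kn(1)] by auto
  then have "has_section (a 1) ([y k] @ t) switch"
    using has_section_append[OF first(1)] by blast
  then have "a 1 (([y k] @ t) @ [0]) = ([y k] @ t) @ [1]"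
    unfolding has_section_def by simp
  then have q: "a 1 (([y k] @ t) @ [0]) \<noteq> ([y k] @ t) @ [0]"
    by simp
  \<comment> \<open>Leave the path to \<open>b 1\<close> or to \<open>a 1\<close> by the other letter, obtained by adding 1.\<close>
  have "\<exists>r. has_section (a 1) r id"
  proof (cases "k \<ge> 2")
    case True
    then have "has_section (b k) [y (k - 1) + 1] id"
      using kneading_sections_step(2)[OF gen, of "k - 1"] by simp
    then show ?thesis
      using has_section_append[OF first(1)] by blast
  next
    case False
    then have "n \<ge> 2"
      using kn by simp
    then have "has_section (a n) [x (n - 1) + 1] id"
      using kneading_sections_step(4)[OF gen, of "n - 1"] by simp
    then show ?thesis
      using has_section_append[OF first(2)] by blast
  qed
  then show ?thesis
    using non_Hausdorff_at_periodic_point[OF aut _ P q]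
    unfolding non_Hausdorff_element_def by auto
qed

theorem theorem5p3:
  fixes k n :: nat
    and y x :: "nat \<Rightarrow> bit"
    and b a :: "nat \<Rightarrow> word \<Rightarrow> word"
  assumes "k \<ge> 1" and "n \<ge> 1" and "k + n \<ge> 3"
    and "y k \<noteq> x n"
    and "kneading_generators k n y x b a"
  shows "(\<exists>g \<in> carrier (kneading_group k n b a). non_Hausdorff_element boundary_act boundary g) \<and>
         \<not> Hausdorff_space (germinal_groupoid (kneading_group k n b a) boundary_act boundary)"
proof -
  let ?K = "kneading_group k n b a"
  have "a 1 \<in> carrier AutT"
    using assms(2,5) by (simp add: kneading_generators_def)
  then have a1: "a 1 \<in> carrier ?K"
    unfolding kneading_group_def carrier_subgroup_generated
    using assms(2) by (auto intro: generate.incl)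
  have nH: "non_Hausdorff_element boundary_act boundary (a 1)"
    using kneading_first_non_Hausdorff assms by blast
  then obtain p where p: "non_Hausdorff_at boundary_act boundary (a 1) p"
    unfolding non_Hausdorff_element_def by blast
  have "\<one>\<^bsub>AutT\<^esub> \<in> carrier ?K"
    unfolding kneading_group_def carrier_subgroup_generated by (rule generate.one)
  then have "id \<in> carrier ?K"
    by (simp add: AutT_def)
  then have "\<not> Hausdorff_space (germinal_groupoid ?K boundary_act boundary)"
    using non_Hausdorff_groupoid[OF a1 p] by (simp add: boundary_act_id)
  then show ?thesis
    using a1 nH by blast
qed

end
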